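(* Let $F$ be a formally real field and let $A=M_n(F)$ be a split algebra of $2$-power degree $n=2^\ell$, equipped with an orthogonal involution $\sigma$ which is adjoint to an $\ell$-fold Pfister form over $F$. Then the PS Conjecture holds for $(A,\sigma)$; that is, every totally $\sigma$-positive element of $A$ is a sum of hermitian squares in $(A,\sigma)$.
   Context: For an $n$-dimensional nonsingular quadratic form $q$ over $F$ with Gram matrix $H$, the adjoint involution on $M_n(F)$ is $\mathrm{ad}_q(Z)=H\cdot Z^t\cdot H^{-1}$; "$\sigma$ is adjoint to $q$" means that $\sigma=\mathrm{ad}_q$. An $\ell$-fold Pfister form is a form $\langle 1,a_1\rangle\otimes\cdots\otimes\langle 1,a_\ell\rangle$ with $a_i\in F^\times$. Put $\mathrm{Sym}(A,\sigma)=\{a\in A:\sigma(a)=a\}$ and let $\mathrm{Trd}:A\to F$ be the reduced trace (the matrix trace). An ordering $\leq_P$ of the field $F$ is a $\sigma$-ordering if $0\leq_P\mathrm{Trd}(\sigma(x)x)$ for all $x\in A$. An element $a\in\mathrm{Sym}(A,\sigma)$ is $\sigma$-positive with respect to a $\sigma$-ordering $\leq_P$ if $0\leq_P\mathrm{Trd}(\sigma(x)ax)$ for all $x\in A$; it is totally $\sigma$-positive if it is $\sigma$-positive with respect to all $\sigma$-orderings of $F$ (a vacuous condition if there are none). Hermitian squares in $(A,\sigma)$ are elements $\sigma(x)x$ with $x\in A$; sums are finite. "The PS Conjecture holds for $(A,\sigma)$" means: every totally $\sigma$-positive element of $A$ is a sum of hermitian squares in $(A,\sigma)$. *)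

theory Defs
  imports "Jordan_Normal_Form.Matrix"
begin

text \<open>The base field F is the type \<open>'a\<close>, and \<open>A = M\<^sub>n(F)\<close> is \<open>carrier_mat n n\<close>. Quadratic forms on
  \<open>F\<^sup>n\<close> and involutions of \<open>A\<close> are total functions on \<open>'a vec\<close> and \<open>'a mat\<close>; every condition below
  constrains them on \<open>carrier_vec n\<close> and \<open>carrier_mat n n\<close> only.\<close>

definition formally_real :: "'a::field itself \<Rightarrow> bool" where
  "formally_real _ \<longleftrightarrow> \<not> (\<exists>xs :: 'a list. (\<Sum>x\<leftarrow>xs. x\<^sup>2) = - 1)"

definition field_ordering :: "('a::field \<Rightarrow> 'a \<Rightarrow> bool) \<Rightarrow> bool" where
  "field_ordering leP \<longleftrightarrow>
     class.linorder leP (\<lambda>x y. leP x y \<and> \<not> leP y x) \<and>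
     (\<forall>x y z. leP x y \<longrightarrow> leP (x + z) (y + z)) \<and>
     (\<forall>x y. leP 0 x \<longrightarrow> leP 0 y \<longrightarrow> leP 0 (x * y))"

subsection \<open>Quadratic forms\<close>

text \<open>The symmetric Gram matrix determines the form; it is determined by the form when the
  characteristic is not 2, in particular over a formally real field.\<close>

definition gram_matrix :: "nat \<Rightarrow> ('a::field vec \<Rightarrow> 'a) \<Rightarrow> 'a mat \<Rightarrow> bool" where
  "gram_matrix n q H \<longleftrightarrow>
     H \<in> carrier_mat n n \<and> transpose_mat H = H \<and>
     (\<forall>v \<in> carrier_vec n. q v = v \<bullet> (H *\<^sub>v v))"

definition isometric_forms :: "nat \<Rightarrow> ('a::field vec \<Rightarrow> 'a) \<Rightarrow> ('a vec \<Rightarrow> 'a) \<Rightarrow> bool" where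
  "isometric_forms n q q' \<longleftrightarrow>
     (\<exists>P \<in> carrier_mat n n. invertible_mat P \<and> (\<forall>v \<in> carrier_vec n. q v = q' (P *\<^sub>v v)))"

text \<open>The Kronecker product is the Gram matrix of a tensor product of forms.\<close>

definition kronecker :: "'a::semiring_1 mat \<Rightarrow> 'a mat \<Rightarrow> 'a mat" where
  "kronecker A B =
     mat (dim_row A * dim_row B) (dim_col A * dim_col B)
       (\<lambda>(i, j). A $$ (i div dim_row B, j div dim_col B) * B $$ (i mod dim_row B, j mod dim_col B))"

fun pfister_gram :: "'a::field list \<Rightarrow> 'a mat" where
  "pfister_gram [] = 1\<^sub>m 1"
| "pfister_gram (a # as) = kronecker (mat_of_rows_list 2 [[1, 0], [0, a]]) (pfister_gram as)"

text \<open>As usual, forms are considered up to isometry, so that being an \<open>l\<close>-fold Pfister form does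
  not depend on the basis used to write the form.\<close>

definition pfister_form :: "nat \<Rightarrow> ('a::field vec \<Rightarrow> 'a) \<Rightarrow> bool" where
  "pfister_form l q \<longleftrightarrow>
     (\<exists>as. length as = l \<and> 0 \<notin> set as \<and>
           isometric_forms (2 ^ l) q (\<lambda>v. v \<bullet> (pfister_gram as *\<^sub>v v)))"

subsection \<open>Involutions on the matrix algebra\<close>

text \<open>\<open>ad_matrix n H \<sigma>\<close>: \<open>H\<close> is invertible, with inverse \<open>K\<close>, and \<open>\<sigma>(Z) = H Z\<^sup>t H\<^sup>-\<^sup>1\<close> on \<open>M\<^sub>n(F)\<close>.\<close>

definition ad_matrix :: "nat \<Rightarrow> 'a::field mat \<Rightarrow> ('a mat \<Rightarrow> 'a mat) \<Rightarrow> bool" where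
  "ad_matrix n H \<sigma> \<longleftrightarrow>
     H \<in> carrier_mat n n \<and>
     (\<exists>K \<in> carrier_mat n n. inverts_mat H K \<and> inverts_mat K H \<and>
        (\<forall>Z \<in> carrier_mat n n. \<sigma> Z = H * transpose_mat Z * K))"

text \<open>Nonsingularity of \<open>q\<close> is the invertibility of its Gram matrix in \<open>ad_matrix\<close>.\<close>

definition adjoint_to_form :: "nat \<Rightarrow> ('a::field mat \<Rightarrow> 'a mat) \<Rightarrow> ('a vec \<Rightarrow> 'a) \<Rightarrow> bool" where
  "adjoint_to_form n \<sigma> q \<longleftrightarrow> (\<exists>H. gram_matrix n q H \<and> ad_matrix n H \<sigma>)"

text \<open>Involutions of the first kind, that is, fixing the centre \<open>F\<close> of \<open>M\<^sub>n(F)\<close>.\<close>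

definition involution :: "nat \<Rightarrow> ('a::field mat \<Rightarrow> 'a mat) \<Rightarrow> bool" where
  "involution n \<sigma> \<longleftrightarrow>
     \<sigma> \<in> carrier_mat n n \<rightarrow> carrier_mat n n \<and>
     (\<forall>X \<in> carrier_mat n n. \<forall>Y \<in> carrier_mat n n. \<sigma> (X + Y) = \<sigma> X + \<sigma> Y) \<and>
     (\<forall>X \<in> carrier_mat n n. \<forall>Y \<in> carrier_mat n n. \<sigma> (X * Y) = \<sigma> Y * \<sigma> X) \<and>
     (\<forall>X \<in> carrier_mat n n. \<sigma> (\<sigma> X) = X) \<and>
     (\<forall>c. \<sigma> (c \<cdot>\<^sub>m 1\<^sub>m n) = c \<cdot>\<^sub>m 1\<^sub>m n)"

text \<open>In general an involution of the first kind is orthogonal if over a splitting field it becomes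
  adjoint to a symmetric bilinear form (in characteristic not 2). The algebra \<open>M\<^sub>n(F)\<close> is already
  split, so no extension of scalars is needed.\<close>

definition orthogonal_involution :: "nat \<Rightarrow> ('a::field mat \<Rightarrow> 'a mat) \<Rightarrow> bool" where
  "orthogonal_involution n \<sigma> \<longleftrightarrow>
     involution n \<sigma> \<and> (\<exists>H. transpose_mat H = H \<and> ad_matrix n H \<sigma>)"

definition Sym :: "nat \<Rightarrow> ('a::field mat \<Rightarrow> 'a mat) \<Rightarrow> 'a mat set" where
  "Sym n \<sigma> = {a \<in> carrier_mat n n. \<sigma> a = a}"

definition Trd :: "'a::comm_monoid_add mat \<Rightarrow> 'a" where
  "Trd A = (\<Sum>i<dim_row A. A $$ (i, i))"

definition sigma_ordering ::
    "nat \<Rightarrow> ('a::field mat \<Rightarrow> 'a mat) \<Rightarrow> ('a \<Rightarrow> 'a \<Rightarrow> bool) \<Rightarrow> bool" where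
  "sigma_ordering n \<sigma> leP \<longleftrightarrow>
     field_ordering leP \<and> (\<forall>x \<in> carrier_mat n n. leP 0 (Trd (\<sigma> x * x)))"

definition sigma_positive ::
    "nat \<Rightarrow> ('a::field mat \<Rightarrow> 'a mat) \<Rightarrow> ('a \<Rightarrow> 'a \<Rightarrow> bool) \<Rightarrow> 'a mat \<Rightarrow> bool" where
  "sigma_positive n \<sigma> leP a \<longleftrightarrow>
     a \<in> Sym n \<sigma> \<and> (\<forall>x \<in> carrier_mat n n. leP 0 (Trd (\<sigma> x * a * x)))"

definition totally_sigma_positive ::
    "nat \<Rightarrow> ('a::field mat \<Rightarrow> 'a mat) \<Rightarrow> 'a mat \<Rightarrow> bool" where
  "totally_sigma_positive n \<sigma> a \<longleftrightarrow>
     a \<in> Sym n \<sigma> \<and> (\<forall>leP. sigma_ordering n \<sigma> leP \<longrightarrow> sigma_positive n \<sigma> leP a)"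

definition sum_hermitian_squares ::
    "nat \<Rightarrow> ('a::field mat \<Rightarrow> 'a mat) \<Rightarrow> 'a mat \<Rightarrow> bool" where
  "sum_hermitian_squares n \<sigma> a \<longleftrightarrow>
     (\<exists>xs. set xs \<subseteq> carrier_mat n n \<and> a = foldr (+) (map (\<lambda>x. \<sigma> x * x) xs) (0\<^sub>m n n))"

definition PS_conjecture :: "nat \<Rightarrow> ('a::field mat \<Rightarrow> 'a mat) \<Rightarrow> bool" where
  "PS_conjecture n \<sigma> \<longleftrightarrow>
     (\<forall>a. totally_sigma_positive n \<sigma> a \<longrightarrow> sum_hermitian_squares n \<sigma> a)"

subsection \<open>Adjoint involutions are orthogonal\<close>

lemma adjoint_to_form_imp_orthogonal_involution:
  assumes "adjoint_to_form n \<sigma> q"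
  shows "orthogonal_involution n (\<sigma> :: 'a::field mat \<Rightarrow> 'a mat)"
proof -
  from assms obtain H K where H: "H \<in> carrier_mat n n" and sym: "transpose_mat H = H"
    and ad: "ad_matrix n H \<sigma>" and K: "K \<in> carrier_mat n n"
    and "inverts_mat H K" "inverts_mat K H"
    and \<sigma>: "\<And>Z. Z \<in> carrier_mat n n \<Longrightarrow> \<sigma> Z = H * transpose_mat Z * K"
    unfolding adjoint_to_form_def gram_matrix_def ad_matrix_def by blast
  then have HK: "H * K = 1\<^sub>m n" and KH: "K * H = 1\<^sub>m n"
    using H K unfolding inverts_mat_def by auto
  have tKc: "transpose_mat K \<in> carrier_mat n n"
    using K by simp
  have tKH: "transpose_mat K * H = 1\<^sub>m n"
    using transpose_mult[OF H K] HK sym by simp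
  have "transpose_mat K = transpose_mat K * (H * K)"
    using tKc by (simp add: HK)
  also have "\<dots> = transpose_mat K * H * K"
    using assoc_mult_mat[OF tKc H K] by simp
  finally have tK: "transpose_mat K = K"
    using K by (simp add: tKH)
  have cancel: "K * (H * X) = X" "H * (K * X) = X" if X: "X \<in> carrier_mat n n" for X
    using assoc_mult_mat[OF K H X] assoc_mult_mat[OF H K X] X by (simp_all add: HK KH)
  have closed: "\<sigma> X \<in> carrier_mat n n" if "X \<in> carrier_mat n n" for X
    using that H K by (simp add: \<sigma>)
  have add: "\<sigma> (X + Y) = \<sigma> X + \<sigma> Y" if X: "X \<in> carrier_mat n n" and Y: "Y \<in> carrier_mat n n" for X Y
  proof -
    have "transpose_mat (X + Y) = transpose_mat X + transpose_mat Y"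
      by (rule transpose_add[OF X Y])
    moreover have "H * (transpose_mat X + transpose_mat Y)
        = H * transpose_mat X + H * transpose_mat Y"
      using H X Y by (intro mult_add_distrib_mat[of _ n n _ n]) auto
    moreover have "(H * transpose_mat X + H * transpose_mat Y) * K
        = H * transpose_mat X * K + H * transpose_mat Y * K"
      using H K X Y by (intro add_mult_distrib_mat[of _ n n _ _ n]) auto
    ultimately show ?thesis using X Y by (simp add: \<sigma>)
  qed
  have mult: "\<sigma> (X * Y) = \<sigma> Y * \<sigma> X" if X: "X \<in> carrier_mat n n" and Y: "Y \<in> carrier_mat n n" for X Y
    using X Y H K by (simp add: \<sigma> transpose_mult[OF X Y] assoc_mult_mat[of _ n n _ n _ n] cancel)
  have invol: "\<sigma> (\<sigma> X) = X" if X: "X \<in> carrier_mat n n" for X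
  proof -
    have "transpose_mat (H * transpose_mat X * K) = K * (X * H)"
      using X H K by (simp add: transpose_mult[of _ n n _ n] tK sym)
    then show ?thesis
      using X H K HK closed[OF X]
      by (simp add: \<sigma> assoc_mult_mat[of _ n n _ n _ n] cancel)
  qed
  have scal: "\<sigma> (c \<cdot>\<^sub>m 1\<^sub>m n) = c \<cdot>\<^sub>m 1\<^sub>m n" for c
  proof -
    have "transpose_mat (c \<cdot>\<^sub>m 1\<^sub>m n :: 'a mat) = c \<cdot>\<^sub>m 1\<^sub>m n"
      by (intro eq_matI) auto
    then show ?thesis
      using H K HK by (simp add: \<sigma> mult_smult_distrib[of _ n n _ n] mult_smult_assoc_mat[of _ n n _ n])
  qed
  show ?thesis
    unfolding orthogonal_involution_def involution_def
    using closed add mult invol scal sym ad by blast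
qed

end

theory Submission
  imports Defs
begin

text \<open>Let \<open>H\<close> be the Gram matrix of \<open>q\<close>. The diagonal entries of a Pfister form are closed under
  multiplication up to squares, so the sums of values of \<open>q\<close> form a preordering \<open>T\<close>, and by Artin's
  argument \<open>T\<close> is the intersection of the orderings containing it. All these orderings are
  \<open>\<sigma>\<close>-orderings, because \<open>Trd (\<sigma> x * x) \<in> T\<close>. If \<open>a\<close> is totally \<open>\<sigma>\<close>-positive, then the symmetric matrix
  \<open>a H\<close> therefore only takes values in \<open>T\<close>, and diagonalizing it writes it as a sum of matrices
  \<open>t u u\<^sup>t\<close> with \<open>t \<in> T\<close>. Finally \<open>q(w) u u\<^sup>t H\<^sup>-\<^sup>1 = \<sigma> x * x\<close> for \<open>x = H w u\<^sup>t H\<^sup>-\<^sup>1\<close>.\<close>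

subsection \<open>Preorderings\<close>

definition preordering :: "'a::field set \<Rightarrow> bool" where
  "preordering T \<longleftrightarrow>
     (\<forall>x. x\<^sup>2 \<in> T) \<and> (\<forall>x\<in>T. \<forall>y\<in>T. x + y \<in> T) \<and> (\<forall>x\<in>T. \<forall>y\<in>T. x * y \<in> T)"

lemma preorderingI:
  assumes "\<And>x. x\<^sup>2 \<in> T" "\<And>x y. x \<in> T \<Longrightarrow> y \<in> T \<Longrightarrow> x + y \<in> T"
    "\<And>x y. x \<in> T \<Longrightarrow> y \<in> T \<Longrightarrow> x * y \<in> T"
  shows "preordering T"
  using assms by (simp add: preordering_def)

lemma preordering_square: "preordering T \<Longrightarrow> x\<^sup>2 \<in> T"
  and preordering_add: "preordering T \<Longrightarrow> x \<in> T \<Longrightarrow> y \<in> T \<Longrightarrow> x + y \<in> T"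
  and preordering_mult: "preordering T \<Longrightarrow> x \<in> T \<Longrightarrow> y \<in> T \<Longrightarrow> x * y \<in> T"
  by (simp_all add: preordering_def)

lemma preordering_0: "preordering T \<Longrightarrow> 0 \<in> T"
  using preordering_square[of T 0] by simp

lemma preordering_1: "preordering T \<Longrightarrow> 1 \<in> T"
  using preordering_square[of T 1] by simp

lemma preordering_divide:
  assumes T: "preordering T" and "x \<in> T" "y \<in> T"
  shows "x / y \<in> T"
proof -
  \<comment> \<open>Division becomes multiplication by \<open>y\<close> and by a square; for
    \<open>y = 0\<close> both sides are 0 by the convention for division.\<close>
  have "x / y = x * (y * (1 / y)\<^sup>2)"
    by (cases "y = 0") (simp_all add: power2_eq_square)
  then show ?thesis
    using assms preordering_mult preordering_square by metis
qed

text \<open>Since 2 is invertible, every element is a difference of two squares, and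
  \<open>- 1 \<in> T\<close> turns differences into sums.\<close>

lemma preordering_eq_UNIV:
  fixes T :: "'a::field set"
  assumes T: "preordering T" and "- 1 \<in> T" and two: "(2::'a) \<noteq> 0"
  shows "T = UNIV"
proof -
  have "x \<in> T" for x :: 'a
  proof -
    have "((x + 1) / 2)\<^sup>2 - ((x - 1) / 2)\<^sup>2 = ((x + 1)\<^sup>2 - (x - 1)\<^sup>2) / 2\<^sup>2"
      unfolding power_divide by (rule diff_divide_distrib[symmetric])
    also have "(x + 1)\<^sup>2 - (x - 1)\<^sup>2 = x * 2\<^sup>2"
      by (simp add: power2_eq_square algebra_simps)
    also have "x * 2\<^sup>2 / 2\<^sup>2 = x"
      using two by (intro nonzero_mult_div_cancel_right power_not_zero)
    finally have "x = ((x + 1) / 2)\<^sup>2 + (- 1) * ((x - 1) / 2)\<^sup>2"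
      by (simp only: mult_minus1 diff_conv_add_uminus)
    then show ?thesis
      using preordering_add[OF T preordering_square[OF T]
          preordering_mult[OF T \<open>- 1 \<in> T\<close> preordering_square[OF T]]] by metis
  qed
  then show ?thesis by auto
qed

text \<open>The witness T - d T is the least preordering containing T and -d. If -1 = s - d t with t
  nonzero, then d = (1 + s) / t lies in T; if t = 0, then -1 lies in T and T is everything. Both
  contradict \<open>d \<notin> T\<close>.\<close>

lemma preordering_adjoin_uminus:
  fixes T :: "'a::field set"
  assumes T: "preordering T" and d: "d \<notin> T" and two: "(2::'a) \<noteq> 0"
  obtains T' where "preordering T'" "T \<subseteq> T'" "- d \<in> T'" "- 1 \<notin> T'"
proof
  let ?T = "{s - d * t | s t. s \<in> T \<and> t \<in> T}"
  show sub: "T \<subseteq> ?T"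
    using preordering_0[OF T] by force
  show "- d \<in> ?T"
    using preordering_0[OF T] preordering_1[OF T] by force
  show "preordering ?T"
  proof (rule preorderingI)
    show "x\<^sup>2 \<in> ?T" for x
      using sub preordering_square[OF T] by blast
    fix x y assume "x \<in> ?T" "y \<in> ?T"
    then obtain s t s' t' where *: "x = s - d * t" "y = s' - d * t'"
      and mem: "s \<in> T" "t \<in> T" "s' \<in> T" "t' \<in> T" by blast
    have "x + y = (s + s') - d * (t + t')"
      by (simp add: * algebra_simps)
    then show "x + y \<in> ?T"
      using mem preordering_add[OF T] by blast
    have "x * y = (s * s' + d\<^sup>2 * (t * t')) - d * (s * t' + s' * t)"
      by (simp add: * algebra_simps power2_eq_square)
    moreover have "s * s' + d\<^sup>2 * (t * t') \<in> T" "s * t' + s' * t \<in> T"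
      using mem by (auto intro!: preordering_add[OF T] preordering_mult[OF T] preordering_square[OF T])
    ultimately show "x * y \<in> ?T" by blast
  qed
  show "- 1 \<notin> ?T"
  proof
    assume "- 1 \<in> ?T"
    then obtain s t where st: "- 1 = s - d * t" "s \<in> T" "t \<in> T" by blast
    have dt: "d * t = 1 + s"
      using st(1) by (simp add: algebra_simps eq_diff_eq)
    show False
    proof (cases "t = 0")
      case True
      then have "- 1 \<in> T" using st by simp
      then show False using preordering_eq_UNIV[OF T _ two] d by blast
    next
      case False
      then have "d = (1 + s) / t" using dt by (simp add: field_simps)
      then show False
        using d st preordering_divide[OF T] preordering_add[OF T] preordering_1[OF T] by metis
    qed
  qed
qed

section \<open>From preorderings to orderings\<close>

lemma field_ordering_of_cone:
  fixes Q :: "'a::field set"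
  assumes Q: "preordering Q" and neg: "- 1 \<notin> Q" and total: "\<And>x. x \<in> Q \<or> - x \<in> Q"
  shows "field_ordering (\<lambda>x y. y - x \<in> Q)"
proof -
  \<comment> \<open>A nonzero x with x and -x in Q would put their quotient -1 into Q.\<close>
  have antisym: "x = 0" if "x \<in> Q" "- x \<in> Q" for x
  proof (rule ccontr)
    assume "x \<noteq> 0"
    then have "- 1 = (- x) / x" by simp
    then show False using neg preordering_divide[OF Q that(2,1)] by metis
  qed
  have trans: "z - x \<in> Q" if "y - x \<in> Q" "z - y \<in> Q" for x y z
    using preordering_add[OF Q that] by simp
  have eq: "x = y" if "y - x \<in> Q" "x - y \<in> Q" for x y
    using antisym[of "y - x"] that by simp
  have tot: "y - x \<in> Q \<or> x - y \<in> Q" for x y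
    using total[of "y - x"] by simp
  show ?thesis
    unfolding field_ordering_def class.linorder_def class.order_def class.preorder_def
      class.linorder_axioms_def class.order_axioms_def
    using trans eq tot preordering_mult[OF Q] preordering_0[OF Q] by auto
qed

text \<open>Zorn's lemma extends T - d T to a maximal preordering Q without -1, which is the
  positive cone of an ordering. It contains -d, so it cannot contain the nonzero element d as
  well.\<close>

lemma preordering_separation:
  fixes T :: "'a::field set"
  assumes T: "preordering T" and d: "d \<notin> T" and two: "(2::'a) \<noteq> 0"
  obtains leP where "field_ordering leP" "\<And>t. t \<in> T \<Longrightarrow> leP 0 t" "\<not> leP 0 d"
proof -
  obtain T' where T': "preordering T'" "T \<subseteq> T'" "- d \<in> T'" "- 1 \<notin> T'"
    using preordering_adjoin_uminus[OF T d two] .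
  define A where "A = {Q. preordering Q \<and> T' \<subseteq> Q \<and> - 1 \<notin> Q}"
  have "\<exists>Q\<in>A. \<forall>X\<in>A. Q \<subseteq> X \<longrightarrow> X = Q"
  proof (rule subset_Zorn_nonempty)
    show "A \<noteq> {}" using T' by (auto simp: A_def)
    fix C assume "C \<noteq> {}" and chain: "subset.chain A C"
    have CA: "C \<subseteq> A" using chain by (simp add: subset.chain_def)
    have common: "\<exists>Q\<in>C. x \<in> Q \<and> y \<in> Q" if "x \<in> \<Union>C" "y \<in> \<Union>C" for x y
      using that chain unfolding subset.chain_def by blast
    have "preordering (\<Union>C)"
    proof (rule preorderingI)
      show "x\<^sup>2 \<in> \<Union>C" for x
        using \<open>C \<noteq> {}\<close> CA preordering_square unfolding A_def by blast
      fix x y assume "x \<in> \<Union>C" "y \<in> \<Union>C"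
      then obtain Q where Q: "Q \<in> C" "x \<in> Q" "y \<in> Q" using common by blast
      then have "preordering Q" using CA by (auto simp: A_def)
      then show "x + y \<in> \<Union>C" "x * y \<in> \<Union>C"
        using Q preordering_add preordering_mult by blast+
    qed
    then show "\<Union>C \<in> A" using \<open>C \<noteq> {}\<close> CA by (auto simp: A_def)
  qed
  then obtain Q where Q: "preordering Q" "T' \<subseteq> Q" "- 1 \<notin> Q"
    and max: "\<And>X. X \<in> A \<Longrightarrow> Q \<subseteq> X \<Longrightarrow> X = Q"
    by (auto simp: A_def)
  \<comment> \<open>If x is outside Q, then -x can be adjoined without producing -1, so by
    maximality -x was already in Q.\<close>
  have total: "x \<in> Q \<or> - x \<in> Q" for x
  proof (cases "x \<in> Q")
    case False
    obtain Q' where "preordering Q'" "Q \<subseteq> Q'" "- x \<in> Q'" "- 1 \<notin> Q'"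
      using preordering_adjoin_uminus[OF Q(1) False two] .
    then show ?thesis using max[of Q'] Q(2) by (auto simp: A_def)
  qed simp
  have "d \<notin> Q"
  proof
    assume "d \<in> Q"
    moreover have "- d \<in> Q" using T' Q by blast
    moreover have "d \<noteq> 0" using d preordering_0[OF T] by blast
    then have "- 1 = (- d) / d" by simp
    ultimately show False using preordering_divide[OF Q(1)] Q(3) by metis
  qed
  then show thesis
    using that[OF field_ordering_of_cone[OF Q(1,3) total]] T'(2) Q(2) by auto
qed

text \<open>In characteristic 2 the square of 1 already equals -1.\<close>

lemma formally_real_two_neq_zero:
  assumes "formally_real TYPE('a::field)"
  shows "(2::'a) \<noteq> 0"
proof
  assume "(2::'a) = 0"
  then have "(\<Sum>x\<leftarrow>[1::'a]. x\<^sup>2) = - 1"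
    by (simp add: eq_neg_iff_add_eq_0)
  then show False using assms unfolding formally_real_def by blast
qed

subsection \<open>Rank-one matrices\<close>

definition outer :: "'a::semiring_0 vec \<Rightarrow> 'a vec \<Rightarrow> 'a mat" where
  "outer u v = mat (dim_vec u) (dim_vec v) (\<lambda>(i, j). u $ i * v $ j)"

lemma outer_carrier [simp]:
  "u \<in> carrier_vec m \<Longrightarrow> v \<in> carrier_vec n \<Longrightarrow> outer u v \<in> carrier_mat m n"
  by (simp add: outer_def)

lemma outer_index [simp]:
  "i < dim_vec u \<Longrightarrow> j < dim_vec v \<Longrightarrow> outer u v $$ (i, j) = u $ i * v $ j"
  by (simp add: outer_def)

lemma outer_dim [simp]: "dim_row (outer u v) = dim_vec u" "dim_col (outer u v) = dim_vec v"
  by (simp_all add: outer_def)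

lemma transpose_outer: "transpose_mat (outer u v) = outer v (u :: 'a::comm_semiring_0 vec)"
  by (rule eq_matI) (auto simp: mult.commute)

lemma mult_outer:
  fixes A :: "'a::comm_semiring_0 mat"
  assumes "A \<in> carrier_mat m n" "u \<in> carrier_vec n"
  shows "A * outer u v = outer (A *\<^sub>v u) v"
  using assms
  by (intro eq_matI) (auto simp: scalar_prod_def sum_distrib_right mult.assoc intro!: sum.cong)

lemma outer_mult_outer:
  fixes u :: "'a::comm_semiring_0 vec"
  assumes "v \<in> carrier_vec n" "w \<in> carrier_vec n"
  shows "outer u v * outer w x = (v \<bullet> w) \<cdot>\<^sub>m outer u x"
  using assms
  by (intro eq_matI)
    (auto simp: scalar_prod_def sum_distrib_right sum_distrib_left mult_ac intro!: sum.cong)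

lemma outer_mult_vec:
  fixes u :: "'a::comm_semiring_0 vec"
  assumes "v \<in> carrier_vec n" "w \<in> carrier_vec n"
  shows "outer u v *\<^sub>v w = (v \<bullet> w) \<cdot>\<^sub>v u"
  using assms
  by (intro eq_vecI)
    (auto simp: scalar_prod_def sum_distrib_right sum_distrib_left mult_ac intro!: sum.cong)

lemma Trd_outer:
  assumes "u \<in> carrier_vec n" "v \<in> carrier_vec n"
  shows "Trd (outer u v) = u \<bullet> v"
  using assms by (auto simp: Trd_def scalar_prod_def intro!: sum.cong)

lemma Trd_add:
  assumes "A \<in> carrier_mat n n" "B \<in> carrier_mat n n"
  shows "Trd (A + B) = Trd A + Trd B"
  using assms by (auto simp: Trd_def sum.distrib)

lemma Trd_smult:
  assumes "A \<in> carrier_mat n n"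
  shows "Trd (c \<cdot>\<^sub>m A) = (c :: 'a::comm_semiring_0) * Trd A"
  using assms by (auto simp: Trd_def sum_distrib_left)

text \<open>This is cyclicity of the trace for u u^t M, done by exchanging the two sums.\<close>

lemma Trd_outer_mult:
  fixes u :: "'a::comm_semiring_0 vec"
  assumes "u \<in> carrier_vec n" "M \<in> carrier_mat n n"
  shows "Trd (outer u u * M) = u \<bullet> (M *\<^sub>v u)"
proof -
  have "Trd (outer u u * M) = (\<Sum>i<n. \<Sum>j<n. u $ i * u $ j * M $$ (j, i))"
    using assms by (auto simp: Trd_def scalar_prod_def atLeast0LessThan intro!: sum.cong)
  also have "\<dots> = (\<Sum>j<n. \<Sum>i<n. u $ i * u $ j * M $$ (j, i))"
    by (rule sum.swap)
  also have "\<dots> = u \<bullet> (M *\<^sub>v u)"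
    using assms
    by (auto simp: scalar_prod_def atLeast0LessThan sum_distrib_left mult_ac intro!: sum.cong)
  finally show ?thesis .
qed

subsection \<open>Symmetric matrices with values in a preordering\<close>

text \<open>These are the Gram matrices of sums of squares of linear forms with weights in T. The
  target of the diagonalization is stated this way so that both traces and hermitian squares can be
  treated one summand at a time.\<close>

inductive_set rank_one_sums :: "nat \<Rightarrow> 'a::comm_ring_1 set \<Rightarrow> 'a mat set" for n T where
  zero: "0\<^sub>m n n \<in> rank_one_sums n T"
| add: "S \<in> rank_one_sums n T \<Longrightarrow> t \<in> T \<Longrightarrow> u \<in> carrier_vec n \<Longrightarrow>
    S + t \<cdot>\<^sub>m outer u u \<in> rank_one_sums n T"

lemma rank_one_sums_carrier: "S \<in> rank_one_sums n T \<Longrightarrow> S \<in> carrier_mat n n"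
  by (induction rule: rank_one_sums.induct) auto

lemma sym_mat_scalar_prod:
  fixes S :: "'a::comm_ring_1 mat"
  assumes S: "S \<in> carrier_mat n n" "transpose_mat S = S"
    and v: "v \<in> carrier_vec n" "w \<in> carrier_vec n"
  shows "v \<bullet> (S *\<^sub>v w) = w \<bullet> (S *\<^sub>v v)"
proof -
  have "v \<bullet> (S *\<^sub>v w) = (S *\<^sub>v w) \<bullet> v"
    using assms by (intro comm_scalar_prod) auto
  also have "\<dots> = w \<bullet> (S *\<^sub>v v)"
    using transpose_vec_mult_scalar[of S n n v w] assms by simp
  finally show ?thesis .
qed

lemma quadratic_expand:
  fixes S :: "'a::field mat"
  assumes S: "S \<in> carrier_mat n n" "transpose_mat S = S"
    and v: "v \<in> carrier_vec n" "w \<in> carrier_vec n"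
  shows "(v + t \<cdot>\<^sub>v w) \<bullet> (S *\<^sub>v (v + t \<cdot>\<^sub>v w)) =
    v \<bullet> (S *\<^sub>v v) + 2 * t * (v \<bullet> (S *\<^sub>v w)) + t\<^sup>2 * (w \<bullet> (S *\<^sub>v w))"
proof -
  have *: "S *\<^sub>v v \<in> carrier_vec n" "S *\<^sub>v w \<in> carrier_vec n"
    using assms by auto
  show ?thesis
    using assms * sym_mat_scalar_prod[OF S v]
    by (simp add: mult_add_distrib_mat_vec[of _ n n] mult_mat_vec[of _ n n]
        add_scalar_prod_distrib[of _ n] scalar_prod_add_distrib[of _ n] algebra_simps power2_eq_square)
qed

lemma quadratic_add_outer:
  fixes S :: "'a::field mat"
  assumes "S \<in> carrier_mat n n" "u \<in> carrier_vec n" "v \<in> carrier_vec n"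
  shows "v \<bullet> ((S + t \<cdot>\<^sub>m outer u u) *\<^sub>v v) = v \<bullet> (S *\<^sub>v v) + t * (v \<bullet> u)\<^sup>2"
proof -
  have "(t \<cdot>\<^sub>m outer u u) *\<^sub>v v = t \<cdot>\<^sub>v (outer u u *\<^sub>v v)"
    using assms by (intro eq_vecI) auto
  then have "(S + t \<cdot>\<^sub>m outer u u) *\<^sub>v v = S *\<^sub>v v + (t * (u \<bullet> v)) \<cdot>\<^sub>v u"
    using assms
    by (simp add: add_mult_distrib_mat_vec[of _ n n]
        outer_mult_vec[of u n] smult_smult_assoc)
  moreover have "u \<bullet> v = v \<bullet> u"
    using assms by (intro comm_scalar_prod)
  ultimately show ?thesis
    using assms by (simp add: scalar_prod_add_distrib[of _ n] power2_eq_square mult_ac)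
qed

lemma unit_vec_mult_mat:
  fixes S :: "'a::field mat"
  assumes "S \<in> carrier_mat n n" "i < n" "j < n"
  shows "unit_vec n i \<bullet> (S *\<^sub>v unit_vec n j) = S $$ (i, j)"
  using assms by simp


text \<open>This undoes a modification of S by a rank-one term: the square subtracted in completing
  the square, or a term added to create a nonzero pivot.\<close>

lemma rank_one_sums_add_conv:
  assumes "S + t \<cdot>\<^sub>m outer u u \<in> rank_one_sums n T" "- t \<in> T" "u \<in> carrier_vec n"
    and "S \<in> carrier_mat n n"
  shows "S \<in> rank_one_sums n T"
proof -
  have "S = (S + t \<cdot>\<^sub>m outer u u) + (- t) \<cdot>\<^sub>m outer u u"
    using assms(3,4) by (intro eq_matI) auto
  then show ?thesis
    using rank_one_sums.add[OF assms(1-3)] by simp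
qed

text \<open>A positive diagonal entry is cleared by completing the square. If the diagonal entry vanishes
  but its row does not, the form takes all values, so \<open>- 1 \<in> T\<close> and the entry can be changed freely.\<close>

lemma rank_one_sums_of_values:
  fixes S :: "'a::field mat"
  assumes T: "preordering T" and two: "(2::'a) \<noteq> 0"
    and S: "S \<in> carrier_mat n n" "transpose_mat S = S"
    and vals: "\<And>v. v \<in> carrier_vec n \<Longrightarrow> v \<bullet> (S *\<^sub>v v) \<in> T"
  shows "S \<in> rank_one_sums n T"
proof -
  \<comment> \<open>Induction on the size \<open>k\<close> of the leading block outside of which the
    matrix vanishes; zero rows suffice in the condition because symmetry gives zero columns.\<close>
  have "S \<in> rank_one_sums n T"
    if "k \<le> n" "S \<in> carrier_mat n n" "transpose_mat S = S"
      "\<And>v. v \<in> carrier_vec n \<Longrightarrow> v \<bullet> (S *\<^sub>v v) \<in> T"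
      "\<And>i j. i < n \<Longrightarrow> j < n \<Longrightarrow> k \<le> i \<Longrightarrow> S $$ (i, j) = 0" for k and S :: "'a mat"
    using that
  proof (induction k arbitrary: S)
    case 0
    then have "S = 0\<^sub>m n n" by (intro eq_matI) auto
    then show ?case by (simp add: rank_one_sums.zero)
  next
    case (Suc k)
    then have k: "k < n" "k \<le> n" by auto
    define e :: "'a vec" where "e = unit_vec n k"
    have e [simp]: "e \<in> carrier_vec n" "dim_vec e = n" by (simp_all add: e_def)
    have sym_index: "M $$ (i, j) = M $$ (j, i)"
      if "M \<in> carrier_mat n n" "transpose_mat M = M" "i < n" "j < n" for M :: "'a mat" and i j
      using that by (metis carrier_matD index_transpose_mat(1))
    \<comment> \<open>Stated for a general M because it serves both for S itself and for S with its
      zero diagonal entry raised to 1.\<close>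
    have pivot: "M \<in> rank_one_sums n T"
      if M: "M \<in> carrier_mat n n" "transpose_mat M = M"
        and val: "\<And>v. v \<in> carrier_vec n \<Longrightarrow> v \<bullet> (M *\<^sub>v v) \<in> T"
        and supp: "\<And>i j. i < n \<Longrightarrow> j < n \<Longrightarrow> Suc k \<le> i \<Longrightarrow> M $$ (i, j) = 0"
        and c: "M $$ (k, k) \<noteq> 0" for M :: "'a mat"
    proof -
      let ?c = "M $$ (k, k)"
      define s where "s = M *\<^sub>v e"
      have s: "s \<in> carrier_vec n" using M by (simp add: s_def)
      have s_index: "s $ i = M $$ (i, k)" if "i < n" for i
        using that M k by (simp add: s_def e_def)
      have c_eq: "e \<bullet> s = ?c"
        using unit_vec_mult_mat[OF M(1) k(1) k(1)] by (simp add: e_def s_def)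
      have cT: "1 / ?c \<in> T"
        using val[OF e(1)] c_eq preordering_divide[OF T preordering_1[OF T]] by (simp add: s_def)
      define M' where "M' = M + (- (1 / ?c)) \<cdot>\<^sub>m outer s s"
      have "M' \<in> rank_one_sums n T"
      proof (rule Suc.IH[OF k(2)])
        show M': "M' \<in> carrier_mat n n"
          using M s by (simp add: M'_def)
        show "transpose_mat M' = M'"
          using M s sym_index[OF M] by (intro eq_matI) (auto simp: M'_def mult_ac)
        show "M' $$ (i, j) = 0" if "i < n" "j < n" "k \<le> i" for i j
        proof (cases "i = k")
          case True
          then show ?thesis
            using that M s c sym_index[OF M, of k j] by (simp add: M'_def s_index)
        next
          case False
          then show ?thesis
            using that M s supp k by (simp add: M'_def s_index)
        qed
        fix v :: "'a vec" assume v: "v \<in> carrier_vec n"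
        \<comment> \<open>The vector v + t e is the projection of v onto the M-orthogonal complement
          of e. The value of M' at v is the value of M there, so M' inherits values in T.\<close>
        let ?t = "- (v \<bullet> s) / ?c"
        have "v \<bullet> (M' *\<^sub>v v) = v \<bullet> (M *\<^sub>v v) - (v \<bullet> s)\<^sup>2 / ?c"
          using quadratic_add_outer[OF M(1) s v, of "- (1 / ?c)"] by (simp add: M'_def)
        also have "\<dots> = v \<bullet> (M *\<^sub>v v) + 2 * ?t * (v \<bullet> s) + ?t\<^sup>2 * ?c"
          using c by (simp add: field_simps power2_eq_square)
        also have "\<dots> = (v + ?t \<cdot>\<^sub>v e) \<bullet> (M *\<^sub>v (v + ?t \<cdot>\<^sub>v e))"
          using quadratic_expand[OF M v e(1), of ?t] c_eq by (simp add: s_def)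
        finally show "v \<bullet> (M' *\<^sub>v v) \<in> T"
          using val[of "v + ?t \<cdot>\<^sub>v e"] v by simp
      qed
      then show ?thesis
        using rank_one_sums_add_conv[of M "- (1 / ?c)" s n T] cT s M by (simp add: M'_def)
    qed
    show ?case
    proof (cases "S $$ (k, k) = 0 \<and> (\<exists>j<n. S $$ (k, j) \<noteq> 0)")
      case False
      show ?thesis
      proof (cases "S $$ (k, k) = 0")
        case True
        then have "S $$ (i, j) = 0" if "i < n" "j < n" "k \<le> i" for i j
          using False that Suc.prems(5)[of i j] by (cases "i = k") auto
        then show ?thesis
          using Suc.IH[OF k(2) Suc.prems(2-4)] by blast
      qed (use pivot Suc.prems in blast)
    next
      case True
      then obtain j where j: "j < n" "S $$ (k, j) \<noteq> 0" by blast
      let ?f = "unit_vec n j :: 'a vec" and ?b = "S $$ (k, j)"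
      have "y \<in> T" for y
      proof -
        \<comment> \<open>As \<open>e\<close> is isotropic for S, the value at f + t e is linear in
          t with slope 2 b; this t solves for the prescribed value y.\<close>
        define t where "t = (y - S $$ (j, j)) / (2 * ?b)"
        have "2 * t * ?b = y - S $$ (j, j)"
          using j two by (simp add: t_def)
        moreover have "S $$ (j, k) = ?b"
          using sym_index Suc.prems j k by blast
        ultimately have "(?f + t \<cdot>\<^sub>v e) \<bullet> (S *\<^sub>v (?f + t \<cdot>\<^sub>v e)) = y"
          using quadratic_expand[OF Suc.prems(2,3) _ e(1), of ?f t] True
            unit_vec_mult_mat[OF Suc.prems(2)] k j
          by (simp add: e_def)
        then show ?thesis
          using Suc.prems(4)[of "?f + t \<cdot>\<^sub>v e"] by simp
      qed
      then have univ: "T = UNIV" by auto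
      have "S + 1 \<cdot>\<^sub>m outer e e \<in> rank_one_sums n T"
      proof (rule pivot)
        show "transpose_mat (S + 1 \<cdot>\<^sub>m outer e e) = S + 1 \<cdot>\<^sub>m outer e e"
          using Suc.prems(2)
          by (intro eq_matI) (auto simp: mult_ac intro: sym_index[OF Suc.prems(2,3)])
      qed (use Suc.prems k True univ in \<open>auto simp: e_def\<close>)
      then show ?thesis
        using rank_one_sums_add_conv univ Suc.prems(2) e by blast
    qed
  qed
  from this[of n S] show ?thesis
    using S vals by auto
qed

text \<open>Each summand t u u^t of S contributes t times the value of M at u.\<close>

lemma Trd_rank_one_sums_mult:
  fixes S :: "'a::field mat"
  assumes "S \<in> rank_one_sums n T" and T: "preordering T"
    and M: "M \<in> carrier_mat n n" "\<And>v. v \<in> carrier_vec n \<Longrightarrow> v \<bullet> (M *\<^sub>v v) \<in> T"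
  shows "Trd (S * M) \<in> T"
  using assms(1)
proof induction
  case zero
  have "Trd (0\<^sub>m n n * M) = 0" using M by (simp add: Trd_def)
  then show ?case using preordering_0[OF T] by simp
next
  case (add S t u)
  have S: "S \<in> carrier_mat n n" using add.hyps rank_one_sums_carrier by blast
  have u: "outer u u \<in> carrier_mat n n" using add.hyps by simp
  have uM: "outer u u * M \<in> carrier_mat n n" using u M by simp
  have "Trd ((S + t \<cdot>\<^sub>m outer u u) * M) = Trd (S * M) + t * (u \<bullet> (M *\<^sub>v u))"
    using S u M uM add.hyps
    by (simp add: add_mult_distrib_mat[of _ n n] Trd_add[of _ n] Trd_smult[of _ n]
        mult_smult_assoc_mat[of _ n n] Trd_outer_mult[of _ n])
  then show ?case
    using add preordering_add[OF T] preordering_mult[OF T] M by metis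
qed

subsection \<open>Sums of values of a Pfister form\<close>

definition value_sums :: "nat \<Rightarrow> ('a::comm_monoid_add vec \<Rightarrow> 'a) \<Rightarrow> 'a set" where
  "value_sums n q = {\<Sum>w\<leftarrow>ws. q w | ws. set ws \<subseteq> carrier_vec n}"

lemma value_sums_add:
  assumes "x \<in> value_sums n q" "y \<in> value_sums n q"
  shows "x + y \<in> value_sums n q"
proof -
  obtain vs ws where "set vs \<subseteq> carrier_vec n" "set ws \<subseteq> carrier_vec n"
    "x = (\<Sum>w\<leftarrow>vs. q w)" "y = (\<Sum>w\<leftarrow>ws. q w)"
    using assms by (auto simp: value_sums_def)
  then show ?thesis
    by (auto simp: value_sums_def intro!: exI[of _ "vs @ ws"])
qed

lemma value_sums_0: "0 \<in> value_sums n q"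
  by (auto simp: value_sums_def intro!: exI[of _ "[]"])

lemma value_sums_value: "w \<in> carrier_vec n \<Longrightarrow> q w \<in> value_sums n q"
  by (auto simp: value_sums_def intro!: exI[of _ "[w]"])

lemma value_sums_sum:
  "(\<And>i. i \<in> I \<Longrightarrow> f i \<in> value_sums n q) \<Longrightarrow> sum f I \<in> value_sums n q"
  by (induction I rule: infinite_finite_induct) (simp_all add: value_sums_0 value_sums_add)

lemma value_sums_induct [consumes 1, case_names zero add]:
  assumes "x \<in> value_sums n q" and "P 0"
    and "\<And>w x. w \<in> carrier_vec n \<Longrightarrow> x \<in> value_sums n q \<Longrightarrow> P x \<Longrightarrow> P (q w + x)"
  shows "P x"
proof -
  have "P (\<Sum>w\<leftarrow>ws. q w)" if "set ws \<subseteq> carrier_vec n" for ws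
    using that
  proof (induction ws)
    case (Cons w ws)
    then show ?case
      using assms(3)[of w "\<Sum>w\<leftarrow>ws. q w"] by (auto simp: value_sums_def)
  qed (simp add: assms)
  then show ?thesis
    using assms(1) by (auto simp: value_sums_def)
qed

section \<open>Gram matrices of Pfister forms\<close>

lemma pfister_gram_carrier: "pfister_gram as \<in> carrier_mat (2 ^ length as) (2 ^ length as)"
  by (induction as) (auto simp: kronecker_def mat_of_rows_list_def)

text \<open>With G the Gram matrix for \<open>as\<close>, the matrix is block diagonal with blocks G
  and a G; the quotient of an index selects the block, the remainder the position in it.\<close>

lemma pfister_gram_Cons_index:
  assumes "i < 2 * 2 ^ length as" "j < 2 * 2 ^ length as"
  shows "pfister_gram (a # as) $$ (i, j) =
    (if i div 2 ^ length as = j div 2 ^ length as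
     then (if i div 2 ^ length as = 0 then 1 else a) *
       pfister_gram as $$ (i mod 2 ^ length as, j mod 2 ^ length as) else 0)"
proof -
  have "i div 2 ^ length as < 2" "j div 2 ^ length as < 2"
    using assms by (simp_all add: less_mult_imp_div_less)
  then show ?thesis
    using assms pfister_gram_carrier[of as]
    by (auto simp: kronecker_def mat_of_rows_list_def less_2_cases_iff)
qed

lemma pfister_gram_offdiag:
  "i < 2 ^ length as \<Longrightarrow> j < 2 ^ length as \<Longrightarrow> i \<noteq> j \<Longrightarrow> pfister_gram as $$ (i, j) = 0"
proof (induction as arbitrary: i j)
  case (Cons a as)
  have "i mod 2 ^ length as \<noteq> j mod 2 ^ length as" if "i div 2 ^ length as = j div 2 ^ length as"
    using that Cons.prems(3) by (metis mult_div_mod_eq)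
  then show ?case
    using Cons by (simp add: pfister_gram_Cons_index del: pfister_gram.simps)
qed simp

lemma pfister_gram_00: "pfister_gram as $$ (0, 0) = 1"
  by (induction as) (simp_all add: pfister_gram_Cons_index del: pfister_gram.simps(2))

text \<open>The diagonal entries are the products over sublists of \<open>as\<close>. Multiplying
  two of them leaves the product over the symmetric difference of the chosen positions, up to the
  square of the common factors.\<close>

lemma pfister_gram_diag_mult:
  "i < 2 ^ length as \<Longrightarrow> j < 2 ^ length as \<Longrightarrow>
    \<exists>k<2 ^ length as. \<exists>s. pfister_gram as $$ (i, i) * pfister_gram as $$ (j, j) =
      pfister_gram as $$ (k, k) * s\<^sup>2"
proof (induction as arbitrary: i j)
  case Nil
  then show ?case by (auto intro!: exI[of _ 1])
next
  case (Cons a as)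
  let ?N = "2 ^ length as :: nat" and ?G = "\<lambda>i. pfister_gram as $$ (i, i)"
  define d where "d = (\<lambda>i :: nat. if i = 0 then 1 else a)"
  have G: "pfister_gram (a # as) $$ (i, i) = d (i div ?N) * ?G (i mod ?N)" if "i < 2 * ?N" for i
    using that by (simp add: pfister_gram_Cons_index d_def del: pfister_gram.simps)
  obtain k s where k: "k < ?N" "?G (i mod ?N) * ?G (j mod ?N) = ?G k * s\<^sup>2"
    using Cons.IH[of "i mod ?N" "j mod ?N"] by auto
  \<comment> \<open>If both entries carry the factor \<open>a\<close>, it becomes a square and m =
    0; otherwise at most one \<open>a\<close> survives and r = 1.\<close>
  have "\<exists>m<2. \<exists>r. d (i div ?N) * d (j div ?N) = d m * r\<^sup>2"
  proof (cases "i div ?N = 0 \<or> j div ?N = 0")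
    case True
    then have "d (i div ?N) * d (j div ?N) = d (if i div ?N = 0 \<and> j div ?N = 0 then 0 else 1) * 1\<^sup>2"
      by (auto simp: d_def)
    then show ?thesis
      by (intro exI[of _ "if i div ?N = 0 \<and> j div ?N = 0 then 0 else 1"] conjI exI[of _ 1]) auto
  next
    case False
    then have "d (i div ?N) * d (j div ?N) = d 0 * a\<^sup>2"
      by (auto simp: d_def power2_eq_square)
    then show ?thesis by (intro exI[of _ 0] conjI exI[of _ a]) auto
  qed
  then obtain m r where m: "m < 2" "d (i div ?N) * d (j div ?N) = d m * r\<^sup>2"
    by blast
  have lt: "m * ?N + k < 2 * ?N"
    using m(1) k(1) by (auto simp: less_2_cases_iff)
  have "pfister_gram (a # as) $$ (i, i) * pfister_gram (a # as) $$ (j, j)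
      = (d (i div ?N) * d (j div ?N)) * (?G (i mod ?N) * ?G (j mod ?N))"
    using Cons.prems by (simp add: G mult_ac del: pfister_gram.simps)
  also have "\<dots> = (d m * ?G k) * (r * s)\<^sup>2"
    by (simp add: m k power_mult_distrib mult_ac)
  also have "d m * ?G k = pfister_gram (a # as) $$ (m * ?N + k, m * ?N + k)"
    using G[OF lt] k(1) by simp
  finally show ?case
    using lt by (auto simp del: pfister_gram.simps)
qed

lemma pfister_value:
  assumes "v \<in> carrier_vec (2 ^ length as)"
  shows "v \<bullet> (pfister_gram as *\<^sub>v v) =
    (\<Sum>i<2 ^ length as. pfister_gram as $$ (i, i) * (v $ i)\<^sup>2)"
proof -
  let ?N = "2 ^ length as :: nat" and ?G = "pfister_gram as"
  have "v \<bullet> (?G *\<^sub>v v) = (\<Sum>i<?N. v $ i * (\<Sum>j<?N. ?G $$ (i, j) * v $ j))"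
    using assms pfister_gram_carrier[of as]
    by (auto simp: scalar_prod_def atLeast0LessThan intro!: sum.cong)
  also have "\<dots> = (\<Sum>i<?N. v $ i * (\<Sum>j<?N. if j = i then ?G $$ (i, i) * v $ i else 0))"
    by (intro sum.cong refl arg_cong2[of _ _ _ _ "(*)"]) (auto simp: pfister_gram_offdiag)
  also have "\<dots> = (\<Sum>i<?N. ?G $$ (i, i) * (v $ i)\<^sup>2)"
    by (intro sum.cong) (auto simp: power2_eq_square mult_ac)
  finally show ?thesis .
qed

text \<open>In diagonal coordinates a product of two values expands into terms that are products of
  two diagonal entries times a square. Each such term is again an entry times a square, hence a
  value of \<open>q\<close>. The entry 1 in position 0 yields all squares.\<close>

lemma pfister_form_value_sums:
  assumes "pfister_form l q"
  shows "preordering (value_sums (2 ^ l) q)" and "\<exists>u\<in>carrier_vec (2 ^ l). q u = 1"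
proof -
  let ?n = "2 ^ l :: nat"
  obtain as P where as: "length as = l" and P: "P \<in> carrier_mat ?n ?n" "invertible_mat P"
    and q: "\<And>v. v \<in> carrier_vec ?n \<Longrightarrow> q v = (P *\<^sub>v v) \<bullet> (pfister_gram as *\<^sub>v (P *\<^sub>v v))"
    using assms by (auto simp: pfister_form_def isometric_forms_def)
  let ?G = "\<lambda>i. pfister_gram as $$ (i, i)" and ?T = "value_sums ?n q"
  obtain R where R: "inverts_mat P R" "inverts_mat R P"
    using P(2) by (auto simp: invertible_mat_def)
  then have PR: "P * R = 1\<^sub>m ?n"
    using P by (simp add: inverts_mat_def)
  \<comment> \<open>\<open>invertible_mat\<close> does not fix the dimensions of the inverse; they
    are read off from the two products.\<close>
  have "dim_row R = ?n"
    using arg_cong[OF R(2)[unfolded inverts_mat_def], of dim_col] P by simp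
  moreover have "dim_col R = ?n"
    using arg_cong[OF PR, of dim_col] by simp
  ultimately have Rc: "R \<in> carrier_mat ?n ?n" by auto
  have q_sum: "q v = (\<Sum>i<?n. ?G i * ((P *\<^sub>v v) $ i)\<^sup>2)" if "v \<in> carrier_vec ?n" for v
    using that P q[OF that] pfister_value[of "P *\<^sub>v v" as] as by simp
  have q_unit: "q (R *\<^sub>v (c \<cdot>\<^sub>v unit_vec ?n k)) = ?G k * c\<^sup>2" if "k < ?n" for k c
  proof -
    let ?e = "c \<cdot>\<^sub>v unit_vec ?n k"
    have "P *\<^sub>v (R *\<^sub>v ?e) = ?e"
      using P Rc PR assoc_mult_mat_vec[of P ?n ?n R ?n ?e] by simp
    then have "q (R *\<^sub>v ?e) = (\<Sum>i<?n. ?G i * (?e $ i)\<^sup>2)"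
      using q_sum[of "R *\<^sub>v ?e"] Rc by simp
    also have "\<dots> = (\<Sum>i<?n. if i = k then ?G k * c\<^sup>2 else 0)"
      using that by (intro sum.cong) auto
    finally show ?thesis using that by simp
  qed
  have entry: "?G k * c\<^sup>2 \<in> ?T" if "k < ?n" for k c
    using value_sums_value[of "R *\<^sub>v (c \<cdot>\<^sub>v unit_vec ?n k)" ?n q] q_unit[OF that] Rc by simp
  have values_mult: "q v * q w \<in> ?T" if "v \<in> carrier_vec ?n" "w \<in> carrier_vec ?n" for v w
  proof -
    have "q v * q w =
      (\<Sum>i<?n. \<Sum>j<?n. (?G i * ?G j) * ((P *\<^sub>v v) $ i * (P *\<^sub>v w) $ j)\<^sup>2)"
      unfolding q_sum[OF that(1)] q_sum[OF that(2)] sum_product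
      by (simp add: power_mult_distrib mult_ac)
    also have "\<dots> \<in> ?T"
    proof (intro value_sums_sum)
      fix i j assume "i \<in> {..<?n}" "j \<in> {..<?n}"
      then obtain k s where "k < ?n" "?G i * ?G j = ?G k * s\<^sup>2"
        using pfister_gram_diag_mult[of i as j] as by auto
      then show "(?G i * ?G j) * ((P *\<^sub>v v) $ i * (P *\<^sub>v w) $ j)\<^sup>2 \<in> ?T"
        using entry[of k "s * ((P *\<^sub>v v) $ i * (P *\<^sub>v w) $ j)"]
        by (simp add: power_mult_distrib mult_ac)
    qed
    finally show ?thesis .
  qed
  have mult: "x * y \<in> ?T" if "x \<in> ?T" "y \<in> ?T" for x y
    using that
  proof (induction rule: value_sums_induct)
    case zero
    then show ?case by (simp add: value_sums_0)
  next
    case (add v x)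
    have "q v * y \<in> ?T"
      using add.prems
      by (induction rule: value_sums_induct)
        (use add.hyps in \<open>simp_all add: value_sums_0 values_mult value_sums_add distrib_left\<close>)
    then show ?case
      using add by (simp add: distrib_right value_sums_add)
  qed
  show "preordering ?T"
    using entry[of 0] mult value_sums_add pfister_gram_00[of as]
    by (intro preorderingI) auto
  show "\<exists>u\<in>carrier_vec ?n. q u = 1"
    using q_unit[of 0 1] Rc pfister_gram_00[of as]
    by (intro bexI[of _ "R *\<^sub>v (1 \<cdot>\<^sub>v unit_vec ?n 0)"]) auto
qed

subsection \<open>Hermitian squares\<close>

lemma sum_hermitian_squares_add:
  assumes "sum_hermitian_squares n \<sigma> a" "sum_hermitian_squares n \<sigma> b"
    and \<sigma>: "\<And>x. x \<in> carrier_mat n n \<Longrightarrow> \<sigma> x \<in> carrier_mat n n"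
  shows "sum_hermitian_squares n \<sigma> (a + b)"
proof -
  let ?S = "\<lambda>xs. foldr (+) (map (\<lambda>x. \<sigma> x * x) xs) (0\<^sub>m n n)"
  obtain xs where xs: "set xs \<subseteq> carrier_mat n n" "a = ?S xs"
    using assms(1) unfolding sum_hermitian_squares_def by blast
  obtain ys where ys: "set ys \<subseteq> carrier_mat n n" "b = ?S ys"
    using assms(2) unfolding sum_hermitian_squares_def by blast
  have S: "?S zs \<in> carrier_mat n n" if "set zs \<subseteq> carrier_mat n n" for zs
    using that by (induction zs) (auto intro!: add_carrier_mat mult_carrier_mat[of _ n n] \<sigma>)
  have "?S (xs @ ys) = ?S xs + ?S ys"
    using xs(1)
  proof (induction xs)
    case (Cons x xs)
    then have "\<sigma> x * x \<in> carrier_mat n n"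
      using \<sigma> by (auto intro!: mult_carrier_mat[of _ n n])
    then show ?case
      using Cons S[of xs] S[OF ys(1)] by (simp add: assoc_add_mat[of _ n n])
  qed (use S[OF ys(1)] in simp)
  then show ?thesis
    unfolding sum_hermitian_squares_def using xs ys by (intro exI[of _ "xs @ ys"]) simp
qed

lemma sum_hermitian_squares_0: "sum_hermitian_squares n \<sigma> (0\<^sub>m n n)"
  by (auto simp: sum_hermitian_squares_def intro!: exI[of _ "[]"])

lemma sum_hermitian_squares_single:
  assumes "x \<in> carrier_mat n n" "\<sigma> x \<in> carrier_mat n n"
  shows "sum_hermitian_squares n \<sigma> (\<sigma> x * x)"
  using assms mult_carrier_mat[OF assms(2,1)]
  by (auto simp: sum_hermitian_squares_def intro!: exI[of _ "[x]"])

text \<open>Only two facts about the Pfister form are carried along: its sums of values form a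
  preordering, and it represents 1.\<close>

locale adjoint_involution =
  fixes n :: nat and \<sigma> :: "'a::field mat \<Rightarrow> 'a mat" and q :: "'a vec \<Rightarrow> 'a" and H K :: "'a mat"
  assumes two: "(2::'a) \<noteq> 0"
    and H: "H \<in> carrier_mat n n" "transpose_mat H = H"
    and K: "K \<in> carrier_mat n n"
    and HK: "H * K = 1\<^sub>m n" and KH: "K * H = 1\<^sub>m n"
    and q: "\<And>v. v \<in> carrier_vec n \<Longrightarrow> q v = v \<bullet> (H *\<^sub>v v)"
    and \<sigma>: "\<And>Z. Z \<in> carrier_mat n n \<Longrightarrow> \<sigma> Z = H * transpose_mat Z * K"
    and preordering_values: "preordering (value_sums n q)"
    and represents_1: "\<exists>u\<in>carrier_vec n. q u = 1"
begin

abbreviation "T \<equiv> value_sums n q"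

lemma \<sigma>_carrier: "x \<in> carrier_mat n n \<Longrightarrow> \<sigma> x \<in> carrier_mat n n"
  using H K by (simp add: \<sigma>)

lemma HK_cancel:
  assumes "X \<in> carrier_mat n m"
  shows "H * (K * X) = X" "K * (H * X) = X"
  using assoc_mult_mat[OF H(1) K assms] assoc_mult_mat[OF K H(1) assms] assms
  by (simp_all add: HK KH)

lemma HK_cancel_vec:
  assumes "v \<in> carrier_vec n"
  shows "H *\<^sub>v (K *\<^sub>v v) = v" "K *\<^sub>v (H *\<^sub>v v) = v"
  using assoc_mult_mat_vec[OF H(1) K assms] assoc_mult_mat_vec[OF K H(1) assms] assms
  by (simp_all add: HK KH)

lemma K_sym: "transpose_mat K = K"
proof -
  have "transpose_mat K * H = 1\<^sub>m n"
    using transpose_mult[OF H(1) K] HK H by simp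
  then have "transpose_mat K * H * K = K"
    using K by simp
  then show ?thesis
    using assoc_mult_mat[of "transpose_mat K" n n H n K n] H K HK by simp
qed

text \<open>The inverse Gram matrix describes the same form in other coordinates: v^t K v = q(K
  v).\<close>

lemma K_values:
  assumes v: "v \<in> carrier_vec n"
  shows "v \<bullet> (K *\<^sub>v v) \<in> T"
proof -
  have "q (K *\<^sub>v v) = (K *\<^sub>v v) \<bullet> v"
    using K v by (simp add: q HK_cancel_vec)
  also have "\<dots> = v \<bullet> (K *\<^sub>v v)"
    using K v by (intro comm_scalar_prod[of _ n]) auto
  finally show ?thesis
    using value_sums_value[of "K *\<^sub>v v" n q] K v by simp
qed

text \<open>Here \<sigma>(x) x is the product of H, a rank-one sum because its values are those of
  \<open>q\<close>, and x^t K x, whose value at v is that of K at x v. So its trace lies in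
  T.\<close>

lemma sigma_ordering_of_nonneg_values:
  assumes leP: "field_ordering leP" and nonneg: "\<And>t. t \<in> T \<Longrightarrow> leP 0 t"
  shows "sigma_ordering n \<sigma> leP"
  unfolding sigma_ordering_def
proof (intro conjI leP ballI nonneg)
  fix x :: "'a mat" assume x: "x \<in> carrier_mat n n"
  have "Trd (H * (transpose_mat x * K * x)) \<in> T"
  proof (rule Trd_rank_one_sums_mult)
    show "H \<in> rank_one_sums n T"
      using rank_one_sums_of_values[OF preordering_values two H]
        value_sums_value[of _ n q] q by simp
    fix v :: "'a vec" assume v: "v \<in> carrier_vec n"
    have "transpose_mat x * K * x *\<^sub>v v = transpose_mat x *\<^sub>v (K *\<^sub>v (x *\<^sub>v v))"
      using x K v by (simp add: assoc_mult_mat_vec[of _ n n _ n])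
    then have "v \<bullet> (transpose_mat x * K * x *\<^sub>v v) = (x *\<^sub>v v) \<bullet> (K *\<^sub>v (x *\<^sub>v v))"
      using x K v transpose_vec_mult_scalar[of x n n v "K *\<^sub>v (x *\<^sub>v v)"]
        comm_scalar_prod[of v n "transpose_mat x *\<^sub>v (K *\<^sub>v (x *\<^sub>v v))"]
        comm_scalar_prod[of "x *\<^sub>v v" n "K *\<^sub>v (x *\<^sub>v v)"] by simp
    then show "v \<bullet> (transpose_mat x * K * x *\<^sub>v v) \<in> T"
      using K_values[of "x *\<^sub>v v"] x v by simp
  qed (use x K preordering_values in auto)
  moreover have "\<sigma> x * x = H * (transpose_mat x * K * x)"
    using x H K by (simp add: \<sigma> assoc_mult_mat[of _ n n _ n _ n])
  ultimately show "Trd (\<sigma> x * x) \<in> T" by simp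
qed

section \<open>Values of totally \<sigma>-positive elements\<close>

lemma Sym_mult_H:
  assumes "a \<in> Sym n \<sigma>"
  shows "a \<in> carrier_mat n n" "transpose_mat (a * H) = a * H"
proof -
  show a: "a \<in> carrier_mat n n" using assms by (simp add: Sym_def)
  have "a = H * transpose_mat a * K"
    using assms a \<sigma>[OF a] by (simp add: Sym_def)
  then have "a * H = H * transpose_mat a * K * H" by simp
  also have "\<dots> = H * transpose_mat a"
    using a H K KH by (simp add: assoc_mult_mat[of _ n n _ n _ n])
  finally show "transpose_mat (a * H) = a * H"
    using transpose_mult[OF a H(1)] H by simp
qed

text \<open>The test element x = H w u^t isolates one value of the form a H: \<sigma>(x) a x equals
  that value times H u u^t, whose trace is q(u) = 1.\<close>

lemma Trd_sigma_outer:
  assumes a: "a \<in> carrier_mat n n" and w: "w \<in> carrier_vec n"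
    and u: "u \<in> carrier_vec n" "q u = 1"
  shows "Trd (\<sigma> (H * outer w u) * a * (H * outer w u)) = w \<bullet> (a * H *\<^sub>v w)"
proof -
  let ?W = "outer w u"
  have W: "?W \<in> carrier_mat n n" "outer u w \<in> carrier_mat n n" using w u by simp_all
  have "\<sigma> (H * ?W) = H * (outer u w * H) * K"
    using H W by (simp add: \<sigma> transpose_mult[OF H(1) W(1)] transpose_outer)
  also have "\<dots> = H * outer u w"
    using H K W HK right_mult_one_mat[OF W(2)] by (simp add: assoc_mult_mat[of _ n n _ n _ n])
  finally have "\<sigma> (H * ?W) * a * (H * ?W) = H * (outer u w * (a * H * ?W))"
    using H W a by (simp add: assoc_mult_mat[of _ n n _ n _ n])
  also have "a * H * ?W = outer (a * H *\<^sub>v w) u"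
    using a H w by (intro mult_outer) auto
  also have "outer u w * \<dots> = (w \<bullet> (a * H *\<^sub>v w)) \<cdot>\<^sub>m outer u u"
    using a H w by (intro outer_mult_outer[of _ n]) auto
  also have "H * \<dots> = (w \<bullet> (a * H *\<^sub>v w)) \<cdot>\<^sub>m outer (H *\<^sub>v u) u"
    using H u by (simp add: mult_smult_distrib[of _ n n _ n] mult_outer[of _ n n])
  finally have "Trd (\<sigma> (H * ?W) * a * (H * ?W)) = (w \<bullet> (a * H *\<^sub>v w)) * ((H *\<^sub>v u) \<bullet> u)"
    using H u by (simp add: Trd_smult[of _ n] Trd_outer[of _ n])
  moreover have "(H *\<^sub>v u) \<bullet> u = 1"
    using H u q[of u] comm_scalar_prod[of "H *\<^sub>v u" n u] by simp
  ultimately show ?thesis by simp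
qed

text \<open>A value outside T would be negative in some ordering that is nonnegative on T. That is a
  \<sigma>-ordering, so positivity of \<open>a\<close> at the test element H w u^t is
  contradicted.\<close>

lemma totally_sigma_positive_values:
  assumes a: "totally_sigma_positive n \<sigma> a" and w: "w \<in> carrier_vec n"
  shows "w \<bullet> (a * H *\<^sub>v w) \<in> T"
proof (rule ccontr)
  assume "w \<bullet> (a * H *\<^sub>v w) \<notin> T"
  then obtain leP where leP: "field_ordering leP" "\<And>t. t \<in> T \<Longrightarrow> leP 0 t"
    and neg: "\<not> leP 0 (w \<bullet> (a * H *\<^sub>v w))"
    using preordering_separation[OF preordering_values _ two] by blast
  obtain u where u: "u \<in> carrier_vec n" "q u = 1"
    using represents_1 by blast
  have "a \<in> carrier_mat n n"
    using a by (simp add: totally_sigma_positive_def Sym_def)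
  moreover have "sigma_positive n \<sigma> leP a"
    using a sigma_ordering_of_nonneg_values[OF leP] by (simp add: totally_sigma_positive_def)
  then have "leP 0 (Trd (\<sigma> (H * outer w u) * a * (H * outer w u)))"
    using H w u by (auto simp: sigma_positive_def)
  ultimately show False
    using neg Trd_sigma_outer[OF _ w u, of a] by simp
qed

section \<open>Assembling the hermitian squares\<close>

lemma sum_hermitian_squares_rank_one:
  assumes "t \<in> T" and u: "u \<in> carrier_vec n"
  shows "sum_hermitian_squares n \<sigma> (t \<cdot>\<^sub>m outer u u * K)"
  using assms(1)
proof (induction rule: value_sums_induct)
  case zero
  have "0 \<cdot>\<^sub>m outer u u * K = 0\<^sub>m n n"
    using u K by (intro eq_matI) (auto simp: scalar_prod_def)
  then show ?case by (simp add: sum_hermitian_squares_0)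
next
  case (add w t)
  define y where "y = H *\<^sub>v w"
  have y: "y \<in> carrier_vec n" using H add.hyps by (simp add: y_def)
  define x where "x = outer y u * K"
  have Z: "outer y u \<in> carrier_mat n n" "outer u y \<in> carrier_mat n n" using y u by simp_all
  then have x: "x \<in> carrier_mat n n" using K by (simp add: x_def)
  \<comment> \<open>With y = H w one gets \<sigma>(x) = u y^t K, and K y = w makes the middle factor
    of \<sigma>(x) x collapse to the scalar y^t w = q(w).\<close>
  have "\<sigma> x = H * (K * outer u y) * K"
    using x Z K by (simp add: \<sigma> x_def transpose_mult[OF Z(1) K] K_sym transpose_outer)
  also have "H * (K * outer u y) = outer u y"
    using u y by (intro HK_cancel[of _ n]) simp
  finally have "\<sigma> x * x = outer u y * (K * outer y u) * K"
    using K Z by (simp add: x_def assoc_mult_mat[of _ n n _ n _ n])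
  also have "K * outer y u = outer w u"
    using K y mult_outer[OF K y] add.hyps by (simp add: y_def HK_cancel_vec)
  also have "outer u y * outer w u = (y \<bullet> w) \<cdot>\<^sub>m outer u u"
    using y add.hyps(1) by (rule outer_mult_outer)
  also have "y \<bullet> w = q w"
    using H add.hyps q comm_scalar_prod[of "H *\<^sub>v w" n w] by (simp add: y_def)
  finally have "sum_hermitian_squares n \<sigma> (q w \<cdot>\<^sub>m outer u u * K)"
    using sum_hermitian_squares_single[of x n \<sigma>] x \<sigma>_carrier by simp
  moreover have "(q w + t) \<cdot>\<^sub>m outer u u * K = q w \<cdot>\<^sub>m outer u u * K + t \<cdot>\<^sub>m outer u u * K"
    using u K
    by (simp add: add_smult_distrib_right_mat[of _ n n] add_mult_distrib_mat[of _ n n])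
  ultimately show ?case
    using sum_hermitian_squares_add add.IH \<sigma>_carrier by metis
qed

lemma sum_hermitian_squares_rank_one_sums:
  assumes "S \<in> rank_one_sums n T"
  shows "sum_hermitian_squares n \<sigma> (S * K)"
  using assms
proof induction
  case zero
  then show ?case using K by (simp add: sum_hermitian_squares_0)
next
  case (add S t u)
  then have "(S + t \<cdot>\<^sub>m outer u u) * K = S * K + t \<cdot>\<^sub>m outer u u * K"
    using rank_one_sums_carrier K by (intro add_mult_distrib_mat[of _ n n]) auto
  then show ?case
    using add sum_hermitian_squares_add sum_hermitian_squares_rank_one \<sigma>_carrier by metis
qed

lemma PS_conjecture: "PS_conjecture n \<sigma>"
  unfolding PS_conjecture_def
proof (intro allI impI)
  fix a assume a: "totally_sigma_positive n \<sigma> a"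
  then have Sym: "a \<in> Sym n \<sigma>" by (simp add: totally_sigma_positive_def)
  have "a * H \<in> rank_one_sums n T"
    using Sym_mult_H[OF Sym] H totally_sigma_positive_values[OF a]
    by (intro rank_one_sums_of_values[OF preordering_values two]) auto
  then have "sum_hermitian_squares n \<sigma> (a * H * K)"
    by (rule sum_hermitian_squares_rank_one_sums)
  also have "a * H * K = a"
    using Sym_mult_H(1)[OF Sym] H K HK by (simp add: assoc_mult_mat[of _ n n _ n _ n])
  finally show "sum_hermitian_squares n \<sigma> a" .
qed

end

theorem corollary4p4:
  fixes \<sigma> :: "'a::field mat \<Rightarrow> 'a mat" and q :: "'a vec \<Rightarrow> 'a" and n l :: nat
  assumes "formally_real TYPE('a)"
    and "n = 2 ^ l"
    and "orthogonal_involution n \<sigma>"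
    and "pfister_form l q"
    and "adjoint_to_form n \<sigma> q"
  shows "PS_conjecture n \<sigma>"
proof -
  obtain H K where "H \<in> carrier_mat n n" "transpose_mat H = H" "K \<in> carrier_mat n n"
    and "\<forall>v \<in> carrier_vec n. q v = v \<bullet> (H *\<^sub>v v)"
    and "inverts_mat H K" "inverts_mat K H"
    and "\<forall>Z \<in> carrier_mat n n. \<sigma> Z = H * transpose_mat Z * K"
    using assms(5) unfolding adjoint_to_form_def gram_matrix_def ad_matrix_def by blast
  then interpret adjoint_involution n \<sigma> q H K
    using formally_real_two_neq_zero[OF assms(1)] pfister_form_value_sums[OF assms(4)] assms(2)
    by unfold_locales (auto simp: inverts_mat_def)
  show ?thesis by (rule PS_conjecture)
qed

end
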